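(* The single disjunction problem is $(m+1)$-split-neighborly. That is: let $d,m\ge1$, let $\mathcal{X}=\{0,1\}^d$, and let $\mathcal{H}$ be the set of all disjunctions over $d$ variables without negations having at least one and at most $m$ variables. Then $(\mathcal{H},\mathcal{X})$ is $(m+1)$-split-neighborly.
   Context: A disjunction without negations with variable set $A\subseteq\{1,\dots,d\}$ is the function $h_A:\{0,1\}^d\to\{0,1\}$, $h_A(x)=\bigvee_{i\in A}x_i$. The elements of $\mathcal{X}$ are called tests. For a nonempty finite set $V$, $\mathbb{E}_{h\in V}[f(h)]=\frac{1}{|V|}\sum_{h\in V}f(h)$. For tests $x,x'$ let $\Delta(x,x')=\{h\in\mathcal{H}: h(x)=0 \wedge h(x')=1\}$. For $\alpha\in(0,\frac12]$, define a directed graph on $\mathcal{X}$ with a directed edge $(x,x')$ iff for every $V\subseteq\Delta(x,x')$, either $|V|\le 1$ or there exists a test $\hat x\in\mathcal{X}$ with $\mathbb{E}_{h\in V}[h(\hat x)]\in[\alpha,1-\alpha]$. The problem is $\frac1\alpha$-split-neighborly if this graph is strongly connected. *)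

theory Defs
  imports Complex_Main "HOL-Library.FuncSet" "Graph_Theory.Digraph_Component"
begin

text \<open>The values 0 and 1 are represented by \<^term>\<open>False\<close> and \<^term>\<open>True\<close>.\<close>

definition avg :: "'h set \<Rightarrow> ('h \<Rightarrow> real) \<Rightarrow> real" where
  "avg V f = (\<Sum>h\<in>V. f h) / real (card V)"

definition Delta :: "('x \<Rightarrow> bool) set \<Rightarrow> 'x \<Rightarrow> 'x \<Rightarrow> ('x \<Rightarrow> bool) set" where
  "Delta H x x' = {h \<in> H. \<not> h x \<and> h x'}"

text \<open>An infinite \<open>V\<close> has \<^term>\<open>card V = 0\<close> and hence imposes no condition: the
  quantifier over \<open>V\<close> effectively ranges over finite sets only.\<close>

definition split_edge :: "real \<Rightarrow> ('x \<Rightarrow> bool) set \<Rightarrow> 'x set \<Rightarrow> 'x \<Rightarrow> 'x \<Rightarrow> bool" where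
  "split_edge \<alpha> H X x x' \<longleftrightarrow>
     (\<forall>V \<subseteq> Delta H x x'. card V \<le> 1 \<or>
        (\<exists>z\<in>X. avg V (\<lambda>h. of_bool (h z)) \<in> {\<alpha>..1 - \<alpha>}))"

definition split_graph ::
    "real \<Rightarrow> ('x \<Rightarrow> bool) set \<Rightarrow> 'x set \<Rightarrow> ('x, 'x \<times> 'x) pre_digraph" where
  "split_graph \<alpha> H X =
     \<lparr> verts = X, arcs = {(x, x') \<in> X \<times> X. split_edge \<alpha> H X x x'},
       tail = fst, head = snd \<rparr>"

definition split_neighborly :: "real \<Rightarrow> ('x \<Rightarrow> bool) set \<Rightarrow> 'x set \<Rightarrow> bool" where
  "split_neighborly k H X \<longleftrightarrow>
     (\<exists>\<alpha>. 0 < \<alpha> \<and> \<alpha> \<le> 1 / 2 \<and> k = 1 / \<alpha> \<and>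
        strongly_connected (split_graph \<alpha> H X))"

definition tests :: "nat \<Rightarrow> (nat \<Rightarrow> bool) set" where
  "tests d = {1..d} \<rightarrow>\<^sub>E UNIV"

text \<open>The restriction to \<^term>\<open>tests d\<close> makes equality of hypotheses coincide with
  equality as functions on \<open>{0,1}\<^sup>d\<close>.\<close>

definition disjunction :: "nat \<Rightarrow> nat set \<Rightarrow> (nat \<Rightarrow> bool) \<Rightarrow> bool" where
  "disjunction d A = (\<lambda>x\<in>tests d. \<exists>i\<in>A. x i)"

definition disjunctions :: "nat \<Rightarrow> nat \<Rightarrow> ((nat \<Rightarrow> bool) \<Rightarrow> bool) set" where
  "disjunctions d m = {disjunction d A | A. A \<subseteq> {1..d} \<and> 1 \<le> card A \<and> card A \<le> m}"

end

theory Submission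
  imports Defs
begin

text \<open>
  Changing a single coordinate \<open>i\<close> of a test is always an edge. Every hypothesis in \<open>V \<subseteq> \<Delta>(x, x')\<close>
  contains the variable \<open>i\<close>, so after removing \<open>i\<close> the members of \<open>V\<close> are distinct sets of at
  most \<open>m - 1\<close> variables. Suppose that \<open>|V| \<ge> 2\<close> and no test splits \<open>V\<close>. Then \<open>|V| > m + 1\<close>,
  as otherwise a variable on which two members of \<open>V\<close> differ would split. Every variable is
  rare (frequency below \<open>\<alpha> = 1 / (m + 1)\<close>) or common (above \<open>1 - \<alpha>\<close>). Adding the rare
  variables to a test one by one never jumps over \<open>[\<alpha>, 1 - \<alpha>]\<close>, so fewer than \<open>\<alpha> |V|\<close>
  members contain a rare variable. Double counting bounds the number of common variables by
  \<open>m - 1\<close>, and each of them is missing from fewer than \<open>\<alpha> |V|\<close> members. At most one member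
  consists of exactly the common variables, so \<open>|V| < 1 + m \<alpha> |V|\<close>, which gives
  \<open>|V| < m + 1\<close>, a contradiction.
\<close>

section \<open>Families of finite sets and balanced hitting sets\<close>

text \<open>This models evaluation: the disjunction over \<open>A\<close> is true at the test with
  ones exactly on \<open>Z\<close> iff \<open>A\<close> meets \<open>Z\<close>.\<close>

definition hits :: "'a set set \<Rightarrow> 'a set \<Rightarrow> nat" where
  "hits F Z = card {A \<in> F. A \<inter> Z \<noteq> {}}"

lemma hits_empty [simp]: "hits F {} = 0"
  by (simp add: hits_def)

lemma hits_insert_le:
  assumes "finite F"
  shows "hits F (insert j Z) \<le> hits F {j} + hits F Z"
proof -
  have "{A \<in> F. A \<inter> insert j Z \<noteq> {}} = {A \<in> F. A \<inter> {j} \<noteq> {}} \<union> {A \<in> F. A \<inter> Z \<noteq> {}}"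
    by auto
  then show ?thesis
    unfolding hits_def by (simp add: card_Un_le)
qed

lemma card_not_containing:
  assumes "finite F"
  shows "card {A \<in> F. j \<notin> A} = card F - hits F {j}"
proof -
  have "{A \<in> F. j \<notin> A} = F - {A \<in> F. A \<inter> {j} \<noteq> {}}"
    by auto
  then show ?thesis
    unfolding hits_def using assms by (simp add: card_Diff_subset)
qed

text \<open>Both sides count the pairs of \<open>j \<in> C\<close> and \<open>A \<in> F\<close> with
  \<open>j \<in> A\<close>.\<close>

lemma sum_hits_singleton:
  assumes "finite F" "finite C"
  shows "(\<Sum>j\<in>C. hits F {j}) = (\<Sum>A\<in>F. card (A \<inter> C))"
proof -
  have "(\<Sum>j\<in>C. hits F {j}) = (\<Sum>j\<in>C. \<Sum>A\<in>F. if j \<in> A then 1 else 0)"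
    using assms by (simp add: hits_def flip: sum.inter_filter)
  also have "\<dots> = (\<Sum>A\<in>F. \<Sum>j\<in>C. if j \<in> A then 1 else 0)"
    by (rule sum.swap)
  also have "\<dots> = (\<Sum>A\<in>F. card (A \<inter> C))"
  proof (rule sum.cong)
    fix A
    have "A \<inter> C = {j \<in> C. j \<in> A}"
      by auto
    then show "(\<Sum>j\<in>C. if j \<in> A then 1 else 0) = card (A \<inter> C)"
      using assms by (simp flip: sum.inter_filter)
  qed simp
  finally show ?thesis .
qed

text \<open>The combinatorial core, used with \<open>k = m - 1\<close>, so that \<alpha> is
  \<open>1 / (k + 2)\<close>; denominators are cleared to stay in the naturals.\<close>

lemma exists_balanced_hitting_set:
  fixes F :: "'a set set" and k :: nat
  assumes F: "finite F" "card F \<ge> 2"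
    and small: "\<And>A. A \<in> F \<Longrightarrow> finite A \<and> card A \<le> k"
  obtains Z where "Z \<subseteq> \<Union>F" "card F \<le> (k + 2) * hits F Z"
    "(k + 2) * hits F Z \<le> (k + 1) * card F"
proof (rule ccontr)
  let ?N = "card F"
  note balanced = that
  assume "\<not> thesis"
  have dich: "(k + 2) * hits F Z < ?N \<or> (k + 1) * ?N < (k + 2) * hits F Z"
    if "Z \<subseteq> \<Union>F" for Z
    using balanced[OF that] \<open>\<not> thesis\<close> by linarith
  define L where "L = {j \<in> \<Union>F. (k + 2) * hits F {j} < ?N}"
  define C where "C = {j \<in> \<Union>F. (k + 1) * ?N < (k + 2) * hits F {j}}"
  have finU: "finite (\<Union>F)"
    using F small by blast
  have fin: "finite L" "finite C"
    unfolding L_def C_def by (rule finite_subset[OF _ finU], blast)+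
  have LC: "\<Union>F = L \<union> C"
    unfolding L_def C_def using dich[of "{j}" for j] by blast
  have "k \<ge> 1"
  proof (rule ccontr)
    assume "\<not> k \<ge> 1"
    then have "k = 0"
      by simp
    then have "A = {}" if "A \<in> F" for A
      using small[OF that] by auto
    then have "F \<subseteq> {{}}"
      by blast
    then have "?N \<le> 1"
      using card_mono[of "{{}}" F] by auto
    then show False
      using F by simp
  qed
  have N: "?N > k + 2"
  proof (rule ccontr)
    assume le: "\<not> ?N > k + 2"
    \<comment> \<open>A variable separating two members lies in at least 1 and at most
      \<open>?N - 1\<close> of them, which is balanced when \<open>?N \<le> k + 2\<close>.\<close>
    obtain A B where AB: "A \<in> F" "B \<in> F" "A \<noteq> B"
      using F by (metis One_nat_def card_le_Suc0_iff_eq not_less_eq_eq numeral_2_eq_2)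
    then obtain j where j: "j \<in> \<Union>F" "\<exists>A\<in>F. j \<in> A" "\<exists>B\<in>F. j \<notin> B"
      by blast
    have "hits F {j} > 0"
      using j F by (auto simp: hits_def card_gt_0_iff)
    then have "?N \<le> (k + 2) * hits F {j}"
      using le mult_le_mono[of "k + 2" "k + 2" 1 "hits F {j}"] by simp
    moreover have "card {A \<in> F. j \<notin> A} > 0"
      using j F by (auto simp: card_gt_0_iff)
    then have "hits F {j} + 1 \<le> ?N"
      unfolding card_not_containing[OF F(1)] by simp
    then have "(k + 2) * (hits F {j} + 1) \<le> (k + 2) * ?N"
      by (rule mult_le_mono2)
    then have "(k + 2) * hits F {j} \<le> (k + 1) * ?N"
      using le by (simp add: algebra_simps)
    ultimately show False
      using dich[of "{j}"] j by simp
  qed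
  have rare: "(k + 2) * hits F Z < ?N" if "finite Z" "Z \<subseteq> L" for Z
    using that
  proof (induction Z)
    case empty
    then show ?case
      using F by simp
  next
    case (insert j Z)
    have "(k + 2) * hits F (insert j Z) \<le> (k + 2) * hits F {j} + (k + 2) * hits F Z"
      unfolding distrib_left[symmetric] by (intro mult_le_mono2 hits_insert_le F)
    \<comment> \<open>Both summands are below \<open>?N\<close>, and \<open>2 \<le> k + 1\<close>,
      so the upper alternative of \<open>dich\<close> is out of reach.\<close>
    also have "\<dots> < 2 * ?N"
      using insert unfolding L_def by auto
    also have "\<dots> \<le> (k + 1) * ?N"
      using \<open>k \<ge> 1\<close> by (intro mult_le_mono1) simp
    finally show ?case
      using dich[of "insert j Z"] insert.prems LC by auto
  qed
  have "card C \<le> k"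
  proof -
    have inter: "card (A \<inter> C) \<le> k" if "A \<in> F" for A
      using small[OF that] card_mono[of A "A \<inter> C"] by auto
    have "card C * ((k + 1) * ?N) \<le> (\<Sum>j\<in>C. (k + 2) * hits F {j})"
      using sum_bounded_below[of C "(k + 1) * ?N" "\<lambda>j. (k + 2) * hits F {j}"]
      by (auto simp: C_def)
    also have "\<dots> = (k + 2) * (\<Sum>A\<in>F. card (A \<inter> C))"
      by (simp only: sum_hits_singleton[OF F(1) fin(2)] sum_distrib_left[symmetric])
    also have "\<dots> \<le> (k + 2) * (?N * k)"
      using sum_bounded_above[of F "\<lambda>A. card (A \<inter> C)" k] inter
      by (intro mult_le_mono2) simp
    finally have "(card C * (k + 1)) * ?N \<le> ((k + 2) * k) * ?N"
      by (simp add: algebra_simps)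
    then have "card C * (k + 1) \<le> (k + 2) * k"
      using F by simp
    \<comment> \<open>The product falls short of the square by exactly 1, which forces
      \<open>card C < k + 1\<close>.\<close>
    also have "\<dots> < (k + 1) * (k + 1)"
      by simp
    finally show ?thesis
      by (simp only: mult_less_cancel2) simp
  qed
  \<comment> \<open>A member that avoids \<open>L\<close> lies inside \<open>C\<close>; if it also
    misses no element of \<open>C\<close>, it equals \<open>C\<close>.\<close>
  have "F \<subseteq> {C} \<union> ({A \<in> F. A \<inter> L \<noteq> {}} \<union> (\<Union>j\<in>C. {A \<in> F. j \<notin> A}))"
    using LC by blast
  then have "?N \<le> card ({C} \<union> ({A \<in> F. A \<inter> L \<noteq> {}} \<union> (\<Union>j\<in>C. {A \<in> F. j \<notin> A})))"
    using F fin by (intro card_mono) auto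
  also have "\<dots> \<le> 1 + (hits F L + (\<Sum>j\<in>C. card {A \<in> F. j \<notin> A}))"
    unfolding hits_def
    by (intro order_trans[OF card_Un_le] add_mono card_UN_le fin) simp_all
  finally have "(k + 2) * ?N \<le> (k + 2) * (1 + (hits F L + (\<Sum>j\<in>C. card {A \<in> F. j \<notin> A})))"
    by (rule mult_le_mono2)
  also have "\<dots> = (k + 2) + (k + 2) * hits F L + (\<Sum>j\<in>C. (k + 2) * (?N - hits F {j}))"
    by (simp only: card_not_containing[OF F(1)] distrib_left sum_distrib_left mult_1_right add.assoc)
  finally have total: "(k + 2) * ?N \<le>
    (k + 2) + (k + 2) * hits F L + (\<Sum>j\<in>C. (k + 2) * (?N - hits F {j}))" .
  have "(k + 2) * (?N - hits F {j}) \<le> ?N" if "j \<in> C" for j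
  proof -
    have "(k + 2) * ?N = (k + 1) * ?N + ?N"
      by simp
    moreover have "(k + 1) * ?N < (k + 2) * hits F {j}"
      using that by (simp only: C_def mem_Collect_eq)
    ultimately show ?thesis
      unfolding diff_mult_distrib2 by linarith
  qed
  then have "(\<Sum>j\<in>C. (k + 2) * (?N - hits F {j})) \<le> card C * ?N"
    using sum_bounded_above[of C "\<lambda>j. (k + 2) * (?N - hits F {j})" ?N] by simp
  also have "\<dots> \<le> k * ?N"
    using \<open>card C \<le> k\<close> by simp
  finally have "(k + 2) * ?N \<le> (k + 2) + (k + 2) * hits F L + k * ?N"
    using total by linarith
  moreover have "(k + 2) * ?N = k * ?N + ?N + ?N"
    by simp
  \<comment> \<open>Cancelling \<open>k * ?N\<close> leaves \<open>2 * ?N\<close> on the left, but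
    \<open>k + 2\<close> and \<open>(k + 2) * hits F L\<close> are each below
    \<open>?N\<close>.\<close>
  ultimately show False
    using N rare[OF fin(1) subset_refl] by linarith
qed

section \<open>Disjunctions and edges that change one coordinate\<close>

definition indicator_test :: "nat \<Rightarrow> nat set \<Rightarrow> nat \<Rightarrow> bool" where
  "indicator_test d Z = (\<lambda>t\<in>{1..d}. t \<in> Z)"

lemma indicator_test_in_tests: "indicator_test d Z \<in> tests d"
  by (simp add: indicator_test_def tests_def)

lemma disjunction_indicator_test:
  assumes "A \<subseteq> {1..d}"
  shows "disjunction d A (indicator_test d Z) \<longleftrightarrow> A \<inter> Z \<noteq> {}"
proof -
  have "(\<exists>i\<in>A. indicator_test d Z i) \<longleftrightarrow> A \<inter> Z \<noteq> {}"
    using assms unfolding indicator_test_def by (auto simp: subset_iff)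
  then show ?thesis
    by (simp add: disjunction_def indicator_test_in_tests)
qed

text \<open>Evaluating at the indicator of \<open>{j}\<close> reveals whether \<open>j\<close>
  belongs to the variable set.\<close>

lemma inj_on_disjunction: "inj_on (disjunction d) (Pow {1..d})"
proof (rule inj_onI)
  fix A B
  assume "A \<in> Pow {1..d}" "B \<in> Pow {1..d}" "disjunction d A = disjunction d B"
  then have "A \<inter> {j} \<noteq> {} \<longleftrightarrow> B \<inter> {j} \<noteq> {}" for j
    by (metis PowD disjunction_indicator_test)
  then show "A = B"
    by auto
qed

lemma fun_upd_in_tests: "x \<in> tests d \<Longrightarrow> i \<in> {1..d} \<Longrightarrow> x(i := b) \<in> tests d"
  by (auto simp: tests_def PiE_def extensional_def)

lemma split_edge_fun_upd:
  assumes "m \<ge> 1" and x: "x \<in> tests d" and i: "i \<in> {1..d}"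
  shows "split_edge (1 / real (m + 1)) (disjunctions d m) (tests d) x (x(i := b))"
  unfolding split_edge_def
proof (intro allI impI)
  fix V
  assume V: "V \<subseteq> Delta (disjunctions d m) x (x(i := b))"
  show "card V \<le> 1 \<or> (\<exists>z\<in>tests d. avg V (\<lambda>h. of_bool (h z)) \<in>
    {1 / real (m + 1)..1 - 1 / real (m + 1)})"
  proof (cases "card V \<le> 1")
    case False
    \<comment> \<open>An infinite \<open>V\<close> would have cardinality 0.\<close>
    then have finV: "finite V"
      by (metis card.infinite zero_le)
    define G where "G = {A \<in> Pow {1..d}. disjunction d A \<in> V}"
    have G: "A \<subseteq> {1..d} \<and> i \<in> A \<and> card A \<le> m" if "A \<in> G" for A
    proof -
      have A: "A \<subseteq> {1..d}" "disjunction d A \<in> V"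
        using that by (auto simp: G_def)
      then have Delta: "disjunction d A \<in> Delta (disjunctions d m) x (x(i := b))"
        using V by blast
      \<comment> \<open>Membership only yields some representing set of size at most
        \<open>m\<close>; injectivity identifies it with \<open>A\<close>.\<close>
      then obtain B where "B \<subseteq> {1..d}" "card B \<le> m" "disjunction d A = disjunction d B"
        by (auto simp: Delta_def disjunctions_def)
      then have "card A \<le> m"
        using A inj_onD[OF inj_on_disjunction, of d A B] by simp
      \<comment> \<open>The two tests differ at most at \<open>i\<close>, so only \<open>i\<close>
        can turn the value from false to true.\<close>
      moreover have "i \<in> A"
        using Delta x fun_upd_in_tests[OF x i, of b]
        by (auto simp: Delta_def disjunction_def split: if_splits)
      ultimately show ?thesis
        using A by simp
    qed
    have injG: "inj_on (disjunction d) G"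
      by (rule inj_on_subset[OF inj_on_disjunction]) (auto simp: G_def)
    have imG: "V = disjunction d ` G"
      using V by (auto simp: G_def Delta_def disjunctions_def)
    have cardG: "card G = card V"
      using imG injG by (simp add: card_image)
    \<comment> \<open>Dropping the shared variable \<open>i\<close> lowers the size bound to
      \<open>m - 1\<close> and keeps the sets distinct.\<close>
    define F where "F = (\<lambda>A. A - {i}) ` G"
    have injF: "inj_on (\<lambda>A. A - {i}) G"
      using G by (intro inj_onI) (metis insert_Diff)
    have cardF: "card F = card V"
      using injF cardG by (simp add: F_def card_image)
    have finG: "finite G"
      using cardG False by (metis card.infinite zero_le)
    have small: "finite A \<and> card A \<le> m - 1" if A: "A \<in> F" for A
    proof -
      obtain B where "B \<in> G" "A = B - {i}"
        using A unfolding F_def by blast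
      then show ?thesis
        using G[of B] finite_subset[of B "{1..d}"] by auto
    qed
    obtain Z where Z: "Z \<subseteq> \<Union>F" "card F \<le> (m - 1 + 2) * hits F Z"
      "(m - 1 + 2) * hits F Z \<le> (m - 1 + 1) * card F"
    proof (rule exists_balanced_hitting_set[of F "m - 1"])
      show "finite F" "card F \<ge> 2"
        using finG cardF False by (auto simp: F_def)
    qed (use small in auto)
    \<comment> \<open>No member of \<open>F\<close> contains \<open>i\<close>, hence neither does
      \<open>Z\<close>, and restoring \<open>i\<close> changes no intersection.\<close>
    have minus_i: "(A - {i}) \<inter> Z = A \<inter> Z" for A
      using Z by (auto simp: F_def)
    let ?z = "indicator_test d Z"
    have "{h \<in> V. h ?z} = disjunction d ` {A \<in> G. A \<inter> Z \<noteq> {}}"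
      using G disjunction_indicator_test by (auto simp: imG)
    then have "card {h \<in> V. h ?z} = card {A \<in> G. A \<inter> Z \<noteq> {}}"
      by (simp add: card_image inj_on_subset[OF injG])
    also have "\<dots> = card ((\<lambda>A. A - {i}) ` {A \<in> G. A \<inter> Z \<noteq> {}})"
      by (rule card_image[symmetric]) (rule inj_on_subset[OF injF], auto)
    also have "(\<lambda>A. A - {i}) ` {A \<in> G. A \<inter> Z \<noteq> {}} = {A \<in> F. A \<inter> Z \<noteq> {}}"
      by (auto simp: F_def minus_i)
    finally have "card {h \<in> V. h ?z} = hits F Z"
      by (simp add: hits_def)
    then have avg: "avg V (\<lambda>h. of_bool (h ?z)) = real (hits F Z) / real (card V)"
      using finV by (simp add: avg_def of_bool_def flip: sum.inter_filter)
    have "card V \<le> (m + 1) * hits F Z" "(m + 1) * hits F Z \<le> m * card V"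
      using Z \<open>m \<ge> 1\<close> by (simp_all add: cardF)
    then have "real (card V) \<le> real (m + 1) * real (hits F Z)"
      "real (m + 1) * real (hits F Z) \<le> real m * real (card V)"
      by (metis of_nat_le_iff of_nat_mult)+
    then have "avg V (\<lambda>h. of_bool (h ?z)) \<in> {1 / real (m + 1)..1 - 1 / real (m + 1)}"
      unfolding avg using False by (auto simp: field_simps)
    then show ?thesis
      using indicator_test_in_tests by blast
  qed simp
qed

section \<open>Strong connectivity\<close>

lemma wf_digraph_split_graph: "wf_digraph (split_graph \<alpha> H X)"
  by unfold_locales (auto simp: split_graph_def)

text \<open>The coordinates in \<open>S\<close> are overwritten one at a time, each along an
  edge.\<close>

lemma reachable_override_on:
  assumes "m \<ge> 1" "x \<in> tests d" "finite S" "S \<subseteq> {1..d}"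
  shows "x \<rightarrow>\<^sup>*\<^bsub>split_graph (1 / real (m + 1)) (disjunctions d m) (tests d)\<^esub> override_on x y S"
  using assms(3,4)
proof (induction S)
  case empty
  show ?case
    unfolding override_on_emptyset
    by (rule wf_digraph.reachable_refl[OF wf_digraph_split_graph]) (simp add: split_graph_def assms)
next
  case (insert i S)
  let ?G = "split_graph (1 / real (m + 1)) (disjunctions d m) (tests d)"
  interpret wf_digraph ?G
    by (rule wf_digraph_split_graph)
  let ?u = "override_on x y S"
  have reach: "x \<rightarrow>\<^sup>*\<^bsub>?G\<^esub> ?u"
    using insert by simp
  then have "?u \<in> verts ?G"
    by (rule reachable_in_verts(2))
  then have u: "?u \<in> tests d"
    by (simp add: split_graph_def)
  have "i \<in> {1..d}"
    using insert.prems by simp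
  then have "(?u, ?u(i := y i)) \<in> arcs ?G"
    unfolding split_graph_def using split_edge_fun_upd[OF assms(1) u] fun_upd_in_tests[OF u] u
    by (auto simp del: of_nat_add of_nat_Suc)
  then have "?u \<rightarrow>\<^bsub>?G\<^esub> ?u(i := y i)"
    by (rule dominatesI[rotated]) (simp add: arc_to_ends_def split_graph_def)
  then show ?case
    using reach unfolding override_on_insert by (rule reachable_adj_trans[rotated])
qed

theorem theorem4p1:
  fixes d m :: nat
  assumes "d \<ge> 1" and "m \<ge> 1"
  shows "split_neighborly (real (m + 1)) (disjunctions d m) (tests d)"
proof -
  let ?G = "split_graph (1 / real (m + 1)) (disjunctions d m) (tests d)"
  have verts: "verts ?G = tests d"
    by (simp add: split_graph_def)
  have "x \<rightarrow>\<^sup>*\<^bsub>?G\<^esub> y" if "x \<in> tests d" "y \<in> tests d" for x y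
  proof -
    \<comment> \<open>Outside \<open>{1..d}\<close> both tests are \<open>undefined\<close>, so they
      agree there.\<close>
    have "override_on x y {1..d} = y"
      using that by (auto simp: override_on_def tests_def PiE_def extensional_def fun_eq_iff)
    then show ?thesis
      using reachable_override_on[OF \<open>m \<ge> 1\<close> that(1), of "{1..d}" y] by simp
  qed
  \<comment> \<open>Strong connectivity also demands a vertex; any indicator test serves.\<close>
  then have "strongly_connected ?G"
    unfolding strongly_connected_def verts using indicator_test_in_tests by blast
  moreover have "0 < 1 / real (m + 1)" "1 / real (m + 1) \<le> 1 / 2"
    using \<open>m \<ge> 1\<close> by (simp_all add: field_simps)
  moreover have "real (m + 1) = 1 / (1 / real (m + 1))"
    by simp
  ultimately show ?thesis
    unfolding split_neighborly_def by blast
qed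

end
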